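(* Let $1\le M\le N$ be integers, $a=(a_1,\dots,a_M)$ and $b=(b_0,b_1,\dots,b_N)$ with all entries positive, and $k\in\mathbb{N}$. Writing $\Omega=\sum_{i=1}^{M-1}n_ia_i$, $$\mathbf{E}\bigl[\beta_{M,N}(a,b)^{ka_M}\bigr]=\prod_{l=0}^{k-1}\ \prod_{n_1,\dots,n_{M-1}=0}^\infty\Bigl[\frac{la_M+b_0+\Omega}{\prod_{j_1=1}^N(la_M+b_0+b_{j_1}+\Omega)}\cdot\frac{\prod_{j_1<j_2}^N(la_M+b_0+b_{j_1}+b_{j_2}+\Omega)}{\prod_{j_1<j_2<j_3}^N(la_M+b_0+b_{j_1}+b_{j_2}+b_{j_3}+\Omega)}\cdots\Bigr],$$ where the bracket is $\prod_{J\subseteq\{1,\dots,N\}}\bigl(la_M+b_0+\sum_{j\in J}b_j+\Omega\bigr)^{(-1)^{|J|}}$.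
   Context: Barnes multiple log-gamma function: for $a=(a_1,\dots,a_M)$, $a_j>0$, $\zeta_M(s,w\,|\,a)=\sum_{k_1,\dots,k_M=0}^\infty(w+k_1a_1+\cdots+k_Ma_M)^{-s}$ for $\Re(s)>M$, $\Re(w)>0$, continued meromorphically in $s$; $L_M(w\,|\,a)=\partial_s\zeta_M(s,w\,|\,a)|_{s=0}$, continued analytically to $w\in\mathbb{C}\setminus(-\infty,0]$; $L_0(w)=-\log w$. Operator $\mathcal{S}_N$: $(\mathcal{S}_Nh)(q\,|\,b)=\sum_{J\subseteq\{1,\dots,N\}}(-1)^{|J|}h\bigl(q+b_0+\sum_{j\in J}b_j\bigr)$. Barnes beta distribution: for $M\le N$ the function $\eta_{M,N}(q\,|\,a,b)=\exp\bigl((\mathcal{S}_NL_M)(q\,|\,a,b)-(\mathcal{S}_NL_M)(0\,|\,a,b)\bigr)$ (with $h=L_M(\cdot\,|\,a)$) is known to be the Mellin transform of a unique probability distribution on $(0,1]$; a random variable with this law is denoted $\beta_{M,N}(a,b)$, i.e. $\mathbf{E}[\beta_{M,N}(a,b)^q]=\eta_{M,N}(q\,|\,a,b)$ for $\Re(q)>-b_0$. *)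

theory Defs
  imports "HOL-Probability.Probability" "HOL-Complex_Analysis.Complex_Analysis"
begin

text \<open>
  A parameter tuple \<open>(a\<^sub>1, \<dots>, a\<^sub>M)\<close> is the restriction of a function \<open>a :: nat \<Rightarrow> real\<close> to
  \<open>{1..M}\<close>, and \<open>(b\<^sub>0, \<dots>, b\<^sub>N)\<close> the restriction of \<open>b\<close> to \<open>{0..N}\<close>; values outside these
  ranges are never used.
\<close>

definition multi_indices :: "nat \<Rightarrow> (nat \<Rightarrow> nat) set" where
  "multi_indices m = {1..m} \<rightarrow>\<^sub>E UNIV"

definition barnes_series :: "nat \<Rightarrow> (nat \<Rightarrow> real) \<Rightarrow> complex \<Rightarrow> complex \<Rightarrow> complex" where
  "barnes_series M a w s =
     (\<Sum>\<^sub>\<infinity>k\<in>multi_indices M. (w + of_real (\<Sum>i=1..M. real (k i) * a i)) powr (- s))"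

text \<open>
  The series is summable for \<open>Re s > M\<close>. A nicely meromorphic function has no removable
  singularities and is \<open>0\<close> at its poles, so it is determined by its values on that
  half-plane. Only used for \<open>Re w > 0\<close>.
\<close>

definition barnes_zeta :: "nat \<Rightarrow> (nat \<Rightarrow> real) \<Rightarrow> complex \<Rightarrow> complex \<Rightarrow> complex" where
  "barnes_zeta M a w =
     (THE f. f nicely_meromorphic_on UNIV \<and> (\<forall>s. Re s > real M \<longrightarrow> f s = barnes_series M a w s))"

text \<open>
  The second branch is the value at \<open>w\<close> of the analytic continuation from the right
  half-plane to the slit plane \<open>- \<real>\<^sub>\<le>\<^sub>0\<close>; on the slit itself the value is immaterial. For
  \<open>M = 0\<close> the series has the single term \<open>w powr (- s)\<close>, which yields \<open>- Ln w\<close>.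
\<close>

definition barnes_L :: "nat \<Rightarrow> (nat \<Rightarrow> real) \<Rightarrow> complex \<Rightarrow> complex" where
  "barnes_L M a w =
     (if Re w > 0 then deriv (barnes_zeta M a w) 0
      else (THE v. \<exists>f. f holomorphic_on (- \<real>\<^sub>\<le>\<^sub>0) \<and>
              (\<forall>z. Re z > 0 \<longrightarrow> f z = deriv (barnes_zeta M a z) 0) \<and> v = f w))"

definition S_op :: "nat \<Rightarrow> (nat \<Rightarrow> real) \<Rightarrow> (complex \<Rightarrow> complex) \<Rightarrow> complex \<Rightarrow> complex" where
  "S_op N b h q =
     (\<Sum>J\<in>Pow {1..N}. (-1) ^ card J * h (q + of_real (b 0) + of_real (\<Sum>j\<in>J. b j)))"

definition barnes_eta ::
    "nat \<Rightarrow> nat \<Rightarrow> (nat \<Rightarrow> real) \<Rightarrow> (nat \<Rightarrow> real) \<Rightarrow> complex \<Rightarrow> complex" where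
  "barnes_eta M N a b q = exp (S_op N b (barnes_L M a) q - S_op N b (barnes_L M a) 0)"

text \<open>
  \<open>barnes_beta_law M N a b D\<close>: the measure \<open>D\<close> is the Barnes beta distribution, i.e. the
  probability distribution on \<open>(0, 1]\<close> with Mellin transform \<open>barnes_eta M N a b\<close>.
\<close>

definition barnes_beta_law ::
    "nat \<Rightarrow> nat \<Rightarrow> (nat \<Rightarrow> real) \<Rightarrow> (nat \<Rightarrow> real) \<Rightarrow> real measure \<Rightarrow> bool" where
  "barnes_beta_law M N a b D \<longleftrightarrow>
     prob_space D \<and> sets D = sets borel \<and> (AE x in D. x \<in> {0<..1}) \<and>
     (\<forall>q. Re q > - b 0 \<longrightarrow>
        has_bochner_integral D (\<lambda>x. complex_of_real x powr q) (barnes_eta M N a b q))"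

text \<open>
  Unconditional infinite products over an arbitrary index set, the multiplicative
  counterpart of \<^const>\<open>has_sum\<close>. As usual for infinite products, the limit must be nonzero.
\<close>

definition has_uncond_prod :: "('i \<Rightarrow> real) \<Rightarrow> real \<Rightarrow> 'i set \<Rightarrow> bool" where
  "has_uncond_prod f p A \<longleftrightarrow>
     p \<noteq> 0 \<and> ((\<lambda>F. \<Prod>x\<in>F. f x) \<longlongrightarrow> p) (finite_subsets_at_top A)"

definition uncond_prod :: "('i \<Rightarrow> real) \<Rightarrow> 'i set \<Rightarrow> real" where
  "uncond_prod f A = (THE p. has_uncond_prod f p A)"

text \<open>
  The factor for \<open>x = l * a M + b 0 + \<Omega>\<close>: subsets \<open>J\<close> of even size contribute to the
  numerator, those of odd size to the denominator.
\<close>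

definition barnes_bracket :: "nat \<Rightarrow> (nat \<Rightarrow> real) \<Rightarrow> real \<Rightarrow> real" where
  "barnes_bracket N b x = (\<Prod>J\<in>Pow {1..N}. (x + (\<Sum>j\<in>J. b j)) powi ((-1) ^ card J))"

end

(*
  The finite differences S_N (and, for the continuation, the analogous differences in the
  directions a_1, ..., a_M) lower the order of growth: an alternating sum of (x + c_J)^z over
  J \<subseteq> S is O(x^(z - |S|)).

  Continuation: summing the M-fold difference of x^(M-s) over the lattice telescopes to w^(M-s).
  Taylor expansion of the difference then expresses w^(M-s) through zeta_M(s), zeta_M(s+1), ...,
  zeta_M(s+K) and a remainder series converging for Re s > M - K - 1. This extends
  H(s) = (s-1)...(s-M) zeta_M(s, w) strip by strip to an entire function; in particular zeta_M
  is holomorphic at 0.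

  Product: zeta_M(s, w) - zeta_M(s, w + a_M) = zeta_{M-1}(s, w), and since N > M - 1 the N-fold
  difference of the series for zeta_{M-1} converges locally uniformly near s = 0, where its
  termwise derivative is minus the logarithm of the claimed product. Hence L_M is never needed
  away from the positive half-line, and zeta_{M-1} need not be continued at all.
*)
theory Submission
  imports Defs
begin

section \<open>Alternating sums over subsets\<close>

lemma sum_Pow_insert:
  fixes g :: "'a set \<Rightarrow> 'b::comm_monoid_add"
  assumes "finite S" "e \<notin> S"
  shows "(\<Sum>J\<in>Pow (insert e S). g J) = (\<Sum>J\<in>Pow S. g J + g (insert e J))"
proof -
  have "inj_on (insert e) (Pow S)"
    using assms by (auto simp: inj_on_def)
  moreover have "Pow S \<inter> insert e ` Pow S = {}"
    using assms by auto
  ultimately show ?thesis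
    using assms by (simp add: Pow_insert sum.union_disjoint sum.reindex sum.distrib)
qed

text \<open>This is a \<open>card S\<close>-fold finite difference of a monomial. Pairing
  \<open>J\<close> with \<open>insert e J\<close> replaces \<open>y ^ p\<close> by
  \<open>y ^ p - (y + c e) ^ p\<close>, of degree below \<open>p\<close> in \<open>y\<close>. So
  each element of \<open>S\<close> uses up one degree, and only a leading coefficient can
  survive.\<close>

lemma alternating_subset_sum_power:
  fixes c :: "'a \<Rightarrow> 'b::{comm_ring_1, ring_char_0}"
  assumes "finite S" "p \<le> card S"
  shows "(\<Sum>J\<in>Pow S. (-1) ^ card J * (x + sum c J) ^ p) =
           (if p = card S then (-1) ^ card S * fact (card S) * prod c S else 0)"
  using assms
proof (induction S arbitrary: p rule: finite_induct)
  case empty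
  then show ?case by simp
next
  case (insert e S)
  define V where "V = (-1) ^ card S * fact (card S) * prod c S"
  have diff: "y ^ p - (y + c e) ^ p = - (\<Sum>k<p. of_nat (p choose k) * c e ^ (p - k) * y ^ k)" for y
    by (simp add: binomial_ring lessThan_Suc_atMost [symmetric] mult_ac)
  have "(\<Sum>J\<in>Pow (insert e S). (-1) ^ card J * (x + sum c J) ^ p) =
          (\<Sum>J\<in>Pow S. (-1) ^ card J * ((x + sum c J) ^ p - (x + sum c J + c e) ^ p))"
    unfolding sum_Pow_insert [OF insert.hyps]
  proof (rule sum.cong [OF refl])
    fix J assume "J \<in> Pow S"
    then have "finite J" "e \<notin> J"
      using insert.hyps finite_subset by auto
    then show "(-1) ^ card J * (x + sum c J) ^ p +
        (-1) ^ card (insert e J) * (x + sum c (insert e J)) ^ p =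
        (-1) ^ card J * ((x + sum c J) ^ p - (x + sum c J + c e) ^ p)"
      by (simp add: algebra_simps)
  qed
  also have "\<dots> = - (\<Sum>J\<in>Pow S. \<Sum>k<p. of_nat (p choose k) * c e ^ (p - k) *
                      ((-1) ^ card J * (x + sum c J) ^ k))"
    unfolding diff by (simp add: sum_distrib_left sum_negf mult_ac)
  also have "\<dots> = - (\<Sum>k<p. of_nat (p choose k) * c e ^ (p - k) *
                      (\<Sum>J\<in>Pow S. (-1) ^ card J * (x + sum c J) ^ k))"
    by (subst sum.swap) (simp add: sum_distrib_left)
  also have "\<dots> = - (\<Sum>k<p. of_nat (p choose k) * c e ^ (p - k) * (if k = card S then V else 0))"
    using insert by (intro arg_cong [of _ _ uminus] sum.cong refl) (auto simp: V_def)
  also have "\<dots> = (if p = Suc (card S) then - (of_nat (Suc (card S)) * c e * V) else 0)"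
    using insert.prems insert.hyps by (auto simp: if_distrib [of "\<lambda>t. _ * t"] sum.delta' cong: if_cong)
  finally show ?case
    using insert.hyps by (simp add: V_def algebra_simps)
qed

text \<open>Taylor expansion of \<open>y powr z\<close> at \<open>x\<close> along the real segment
  up to \<open>x + t\<close>. As \<open>Re z \<le> real L\<close>, the modulus of the
  \<open>L\<close>-th derivative does not increase along the segment and is bounded by its value at
  \<open>x\<close>. The coefficient \<open>(-1) ^ p * pochhammer (- z) p\<close> is the falling
  factorial z(z-1)...(z-p+1).\<close>

lemma powr_Taylor_bound:
  fixes z :: complex
  assumes "0 < x" "0 \<le> t" "0 < L" "Re z \<le> real L"
  shows "cmod (of_real (x + t) powr z -
           (\<Sum>p<L. (-1) ^ p * pochhammer (- z) p / fact p * of_real t ^ p * of_real x powr (z - of_nat p)))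
         \<le> cmod (pochhammer (- z) L) * x powr (Re z - real L) * t ^ L / fact (L - 1)"
proof -
  define f where "f = (\<lambda>i y. (-1) ^ i * pochhammer (- z) i * y powr (z - of_nat i))"
  \<comment> \<open>\<open>complex_Taylor\<close> divides the remainder of degree
    \<open>Suc n\<close> by \<open>fact n\<close>, hence the \<open>fact (L - 1)\<close> in the
    bound.\<close>
  define n where "n = L - 1"
  have L: "L = Suc n" using assms by (simp add: n_def)
  define S where "S = closed_segment (of_real x) (of_real (x + t) :: complex)"
  have "S = of_real ` {x..x + t}"
    using assms unfolding S_def closed_segment_of_real by (simp add: closed_segment_eq_real_ivl)
  then have S: "\<exists>y\<ge>x. u = of_real y" if "u \<in> S" for u
    using that by auto
  have "cmod (f 0 (of_real (x + t)) -
          (\<Sum>i\<le>n. f i (of_real x) * (of_real (x + t) - of_real x) ^ i / fact i))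
        \<le> (cmod (pochhammer (- z) L) * x powr (Re z - real L)) *
            cmod (of_real (x + t) - of_real x) ^ Suc n / fact n"
  proof (rule complex_Taylor [of S])
    show "convex S" "of_real x \<in> S" "of_real (x + t) \<in> S"
      by (auto simp: S_def)
  next
    fix i u assume "u \<in> S"
    then obtain y where y: "y \<ge> x" "u = of_real y" using S by blast
    have "((\<lambda>u. u powr (z - of_nat i)) has_field_derivative
            (z - of_nat i) * u powr (z - of_nat i - 1)) (at u within S)"
      using y assms by (intro has_field_derivative_at_within [OF has_field_derivative_powr]) auto
    from DERIV_cmult [OF this, of "(-1) ^ i * pochhammer (- z) i"]
    show "(f i has_field_derivative f (Suc i) u) (at u within S)"
      by (simp add: f_def pochhammer_rec' algebra_simps)
  next
    fix u assume "u \<in> S"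
    then obtain y where y: "y \<ge> x" "u = of_real y" using S by blast
    have "y powr (Re z - real L) \<le> x powr (Re z - real L)"
      using y assms by (intro powr_mono2') auto
    then show "cmod (f (Suc n) u) \<le> cmod (pochhammer (- z) L) * x powr (Re z - real L)"
      using y assms
      by (simp add: f_def L norm_mult norm_power norm_powr_real_powr mult_left_mono)
  qed
  then show ?thesis
    using assms by (simp add: f_def L lessThan_Suc_atMost mult_ac)
qed

text \<open>After expanding every term at \<open>x\<close>, the moments of order
  \<open>p < card S\<close> cancel by \<open>alternating_subset_sum_power\<close>. With
  \<open>L = card S\<close> the correction sum is empty and a plain decay estimate remains; larger
  \<open>L\<close> gives the asymptotic expansion used for the continuation.\<close>

lemma alternating_powr_bound:
  fixes z :: complex and c :: "'a \<Rightarrow> real"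
  assumes S: "finite S" "\<And>j. j \<in> S \<Longrightarrow> 0 \<le> c j" and x: "0 < x" and L: "0 < L" "Re z \<le> real L"
  shows "cmod ((\<Sum>J\<in>Pow S. (-1) ^ card J * of_real (x + sum c J) powr z) -
           (\<Sum>p=card S..<L. (-1) ^ p * pochhammer (- z) p / fact p *
              (\<Sum>J\<in>Pow S. (-1) ^ card J * of_real (sum c J) ^ p) * of_real x powr (z - of_nat p)))
         \<le> cmod (pochhammer (- z) L) * (\<Sum>J\<in>Pow S. sum c J ^ L) / fact (L - 1) * x powr (Re z - real L)"
proof -
  define D where "D = (\<lambda>p. \<Sum>J\<in>Pow S. (-1) ^ card J * of_real (sum c J) ^ p :: complex)"
  define T where "T = (\<lambda>p. (-1) ^ p * pochhammer (- z) p / fact p * of_real x powr (z - of_nat p))"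
  have D0: "D p = 0" if "p < card S" for p
    using alternating_subset_sum_power [of S p 0 "\<lambda>j. of_real (c j) :: complex"] that S
    by (simp add: D_def)
  have "(\<Sum>p=card S..<L. T p * D p) = (\<Sum>p<L. T p * D p)"
    by (rule sum.mono_neutral_left) (auto simp: D0)
  also have "\<dots> = (\<Sum>J\<in>Pow S. (-1) ^ card J * (\<Sum>p<L. T p * of_real (sum c J) ^ p))"
    unfolding D_def sum_distrib_left by (subst sum.swap) (simp add: mult_ac)
  finally have "(\<Sum>J\<in>Pow S. (-1) ^ card J * of_real (x + sum c J) powr z) - (\<Sum>p=card S..<L. T p * D p) =
      (\<Sum>J\<in>Pow S. (-1) ^ card J *
         (of_real (x + sum c J) powr z - (\<Sum>p<L. T p * of_real (sum c J) ^ p)))"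
    by (simp add: sum_subtractf right_diff_distrib)
  also have "cmod \<dots> \<le> (\<Sum>J\<in>Pow S. cmod (pochhammer (- z) L) * x powr (Re z - real L) * sum c J ^ L / fact (L - 1))"
  proof (rule sum_norm_le)
    fix J assume "J \<in> Pow S"
    then have "0 \<le> sum c J" using S by (intro sum_nonneg) auto
    from powr_Taylor_bound [OF x this L]
    show "cmod ((-1) ^ card J * (of_real (x + sum c J) powr z - (\<Sum>p<L. T p * of_real (sum c J) ^ p)))
      \<le> cmod (pochhammer (- z) L) * x powr (Re z - real L) * sum c J ^ L / fact (L - 1)"
      by (simp add: T_def norm_mult norm_power mult_ac)
  qed
  also have "\<dots> = cmod (pochhammer (- z) L) * (\<Sum>J\<in>Pow S. sum c J ^ L) / fact (L - 1) * x powr (Re z - real L)"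
    by (simp add: sum_distrib_left sum_distrib_right sum_divide_distrib mult_ac)
  finally show ?thesis
    by (simp add: T_def D_def mult_ac)
qed

section \<open>Series over the lattice\<close>

definition lattice_shift :: "nat \<Rightarrow> (nat \<Rightarrow> real) \<Rightarrow> (nat \<Rightarrow> nat) \<Rightarrow> real" where
  "lattice_shift m a n = (\<Sum>i=1..m. real (n i) * a i)"

lemma lattice_shift_nonneg:
  assumes "\<And>i. i \<in> {1..m} \<Longrightarrow> 0 < a i"
  shows "0 \<le> lattice_shift m a n"
  unfolding lattice_shift_def using assms
  by (intro sum_nonneg mult_nonneg_nonneg) (auto intro: less_imp_le)

text \<open>The lattice point is at least \<open>c * real (Suc (n i))\<close> for each of the
  \<open>m\<close> coordinates. Raising these inequalities to the power
  \<open>- \<sigma> / m\<close> and multiplying them bounds the term by a product of one-dimensional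
  series with exponent \<open>\<sigma> / m > 1\<close>.\<close>

lemma summable_on_lattice_powr:
  assumes a: "\<And>i. i \<in> {1..m} \<Longrightarrow> 0 < a i" and w: "0 < w" and \<sigma>: "real m < \<sigma>"
  shows "(\<lambda>n. (w + lattice_shift m a n) powr (- \<sigma>)) summable_on multi_indices m"
proof (cases "m = 0")
  case True
  then show ?thesis by (simp add: multi_indices_def)
next
  case False
  define c where "c = Min (insert w (a ` {1..m}))"
  have c: "0 < c"
    unfolding c_def using a w by (subst Min_gr_iff) auto
  have c_le: "c \<le> w" "\<And>i. i \<in> {1..m} \<Longrightarrow> c \<le> a i"
    unfolding c_def by (rule Min_le; simp)+
  define \<tau> where "\<tau> = \<sigma> / real m"
  have \<tau>: "1 < \<tau>" "real m * \<tau> = \<sigma>"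
    using \<sigma> False by (auto simp: \<tau>_def)
  have "summable (\<lambda>n. real (Suc n) powr (- \<tau>))"
    using \<tau> by (subst summable_Suc_iff) (simp add: summable_real_powr_iff)
  then have "summable (\<lambda>n. norm (c powr (- \<tau>) * real (Suc n) powr (- \<tau>)))"
    by (simp add: summable_mult)
  then have "Infinite_Set_Sum.abs_summable_on (\<lambda>n. c powr (- \<tau>) * real (Suc n) powr (- \<tau>)) UNIV"
    by (simp add: abs_summable_on_nat_iff')
  then have "Infinite_Set_Sum.abs_summable_on
      (\<lambda>g. \<Prod>i\<in>{1..m}. c powr (- \<tau>) * real (Suc (g i)) powr (- \<tau>)) (multi_indices m)"
    unfolding multi_indices_def by (intro abs_summable_on_prod_PiE) auto
  then have "(\<lambda>g. \<Prod>i\<in>{1..m}. c powr (- \<tau>) * real (Suc (g i)) powr (- \<tau>)) summable_on multi_indices m"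
    unfolding abs_summable_equivalent [symmetric] by (rule abs_summable_summable)
  then show ?thesis
  proof (rule summable_on_comparison_test)
    fix n
    have pos: "0 < w + lattice_shift m a n"
      using lattice_shift_nonneg [of m a n] a w by simp
    have "(w + lattice_shift m a n) powr (- \<tau>) \<le> c powr (- \<tau>) * real (Suc (n i)) powr (- \<tau>)"
      if i: "i \<in> {1..m}" for i
    proof -
      have "real (n i) * a i \<le> lattice_shift m a n"
        unfolding lattice_shift_def using a i
        by (intro member_le_sum mult_nonneg_nonneg) (auto intro: less_imp_le)
      moreover have "real (n i) * c \<le> real (n i) * a i"
        using c_le i by (intro mult_left_mono) auto
      ultimately have "c * real (Suc (n i)) \<le> w + lattice_shift m a n"
        using c_le by (simp add: algebra_simps)
      then have "(w + lattice_shift m a n) powr (- \<tau>) \<le> (c * real (Suc (n i))) powr (- \<tau>)"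
        using c \<tau> by (intro powr_mono2') auto
      then show ?thesis using c by (simp add: powr_mult)
    qed
    then have "(\<Prod>i\<in>{1..m}. (w + lattice_shift m a n) powr (- \<tau>)) \<le>
               (\<Prod>i\<in>{1..m}. c powr (- \<tau>) * real (Suc (n i)) powr (- \<tau>))"
      by (intro prod_mono) auto
    also have "(\<Prod>i\<in>{1..m}. (w + lattice_shift m a n) powr (- \<tau>)) = (w + lattice_shift m a n) powr (- \<sigma>)"
      using pos \<tau> by (simp add: powr_powr [symmetric] powr_realpow [symmetric] powr_powr mult.commute)
    finally show "(w + lattice_shift m a n) powr (- \<sigma>) \<le>
               (\<Prod>i\<in>{1..m}. c powr (- \<tau>) * real (Suc (n i)) powr (- \<tau>))" .
  qed auto
qed

section \<open>Dominated lattice series: uniform convergence, holomorphy, termwise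
  derivatives\<close>

context
  fixes m :: nat and a :: "nat \<Rightarrow> real" and w e :: real
    and f :: "(nat \<Rightarrow> nat) \<Rightarrow> complex \<Rightarrow> complex" and C :: "complex \<Rightarrow> real"
  assumes a: "\<And>i. i \<in> {1..m} \<Longrightarrow> 0 < a i" and w: "0 < w"
    and holo: "\<And>n. n \<in> multi_indices m \<Longrightarrow> f n holomorphic_on {s. real m - e < Re s}"
    and C: "continuous_on {s. real m - e < Re s} C"
    and bound: "\<And>n s. n \<in> multi_indices m \<Longrightarrow> real m - e < Re s \<Longrightarrow>
                  cmod (f n s) \<le> C s * (w + lattice_shift m a n) powr (- (Re s + e))"
begin

text \<open>The parameter \<open>e\<close> is the gain in decay, which moves the abscissa of
  convergence from \<open>m\<close> to \<open>m - e\<close>. On a disc the exponent varies with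
  \<open>s\<close>, but it can be replaced by its extreme value at
  \<open>\<sigma> = Re z - r\<close>. Since lattice points are at least \<open>w\<close>, this costs
  only the factor \<open>w powr (\<sigma> - Re s)\<close>, which is continuous in \<open>s\<close>,
  so one summable majorant serves the whole disc.\<close>

lemma lattice_series_uniform_limit:
  assumes "cball z r \<subseteq> {s. real m - e < Re s}" "0 \<le> r"
  shows "uniform_limit (cball z r) (\<lambda>X s. \<Sum>n\<in>X. f n s) (\<lambda>s. \<Sum>\<^sub>\<infinity>n\<in>multi_indices m. f n s)
           (finite_subsets_at_top (multi_indices m))"
proof -
  define \<sigma> where "\<sigma> = Re z - r"
  have "z - of_real r \<in> cball z r"
    using assms by (simp add: dist_norm)
  then have \<sigma>: "real m - e < \<sigma>"
    using subsetD [OF assms(1), of "z - of_real r"] by (simp add: \<sigma>_def)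
  have ge: "\<sigma> \<le> Re s" if "s \<in> cball z r" for s
    using that abs_Re_le_cmod [of "z - s"] by (simp add: \<sigma>_def dist_norm)
  have "continuous_on (cball z r) (\<lambda>s. C s * w powr (\<sigma> - Re s))"
    using w by (intro continuous_intros continuous_on_subset [OF C] assms) auto
  then have "bounded ((\<lambda>s. C s * w powr (\<sigma> - Re s)) ` cball z r)"
    by (intro compact_imp_bounded compact_continuous_image) auto
  then obtain B where B: "\<And>s. s \<in> cball z r \<Longrightarrow> \<bar>C s * w powr (\<sigma> - Re s)\<bar> \<le> B"
    unfolding bounded_iff by (metis image_eqI real_norm_def)
  show ?thesis
  proof (rule Weierstrass_m_test_general)
    fix n s assume n: "n \<in> multi_indices m" and s: "s \<in> cball z r"
    define y where "y = w + lattice_shift m a n"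
    have y: "w \<le> y" "0 < y" using lattice_shift_nonneg [of m a n] a w by (auto simp: y_def)
    have bd: "cmod (f n s) \<le> C s * y powr (- (Re s + e))"
      using bound [OF n, of s] s assms by (auto simp: y_def)
    then have "0 \<le> C s"
      using y by (smt (verit, best) mult_nonpos_nonneg norm_ge_zero powr_gt_zero mult_neg_pos)
    note bd
    also have "y powr (- (Re s + e)) = y powr (\<sigma> - Re s) * y powr (- (\<sigma> + e))"
      using y by (simp add: powr_add [symmetric])
    also have "C s * (y powr (\<sigma> - Re s) * y powr (- (\<sigma> + e))) \<le> C s * (w powr (\<sigma> - Re s) * y powr (- (\<sigma> + e)))"
      using y w ge [OF s] \<open>0 \<le> C s\<close> by (intro mult_left_mono mult_right_mono powr_mono2') auto
    also have "\<dots> \<le> B * y powr (- (\<sigma> + e))"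
      using B [OF s] by (simp add: mult.assoc [symmetric] mult_right_mono)
    finally show "cmod (f n s) \<le> B * (w + lattice_shift m a n) powr (- (\<sigma> + e))"
      by (simp add: y_def)
  next
    show "(\<lambda>n. B * (w + lattice_shift m a n) powr (- (\<sigma> + e))) summable_on multi_indices m"
      using \<sigma> by (intro summable_on_cmult_right summable_on_lattice_powr a w) auto
  qed
qed

lemma lattice_series_summable:
  assumes "real m - e < Re s"
  shows "(\<lambda>n. f n s) summable_on multi_indices m"
proof (rule abs_summable_summable, rule Infinite_Sum.abs_summable_on_comparison_test')
  show "(\<lambda>n. C s * (w + lattice_shift m a n) powr (- (Re s + e))) summable_on multi_indices m"
    using assms by (intro summable_on_cmult_right summable_on_lattice_powr a w) auto
qed (use bound assms in auto)

text \<open>Uniform limits of holomorphic partial sums may be differentiated termwise. The second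
  conclusion later turns the derivative at 0 into a sum of logarithms.\<close>

lemma lattice_series_has_derivative:
  assumes s: "real m - e < Re s"
  obtains D where "((\<lambda>s. \<Sum>\<^sub>\<infinity>n\<in>multi_indices m. f n s) has_field_derivative D) (at s)"
    and "((\<lambda>n. deriv (f n) s) has_sum D) (multi_indices m)"
proof -
  obtain r where r: "0 < r" "cball s r \<subseteq> {s. real m - e < Re s}"
    using s open_halfspace_Re_gt [of "real m - e"] by (auto simp: open_contains_cball)
  have sub: "ball s r \<subseteq> {s. real m - e < Re s}"
    using r ball_subset_cball by blast
  obtain g' where g': "\<And>z. z \<in> ball s r \<Longrightarrow>
      ((\<lambda>s. \<Sum>\<^sub>\<infinity>n\<in>multi_indices m. f n s) has_field_derivative g' z) (at z) \<and>
      ((\<lambda>X. \<Sum>n\<in>X. deriv (f n) z) \<longlongrightarrow> g' z) (finite_subsets_at_top (multi_indices m))"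
  proof (rule has_complex_derivative_uniform_limit
      [OF _ lattice_series_uniform_limit [OF r(2)], where f' = "\<lambda>X z. \<Sum>n\<in>X. deriv (f n) z"])
    have "continuous_on (cball s r) (\<lambda>s. \<Sum>n\<in>X. f n s) \<and>
          (\<forall>w\<in>ball s r. ((\<lambda>s. \<Sum>n\<in>X. f n s) has_field_derivative (\<Sum>n\<in>X. deriv (f n) w)) (at w))"
      if X: "X \<subseteq> multi_indices m" for X
    proof (intro conjI ballI)
      show "continuous_on (cball s r) (\<lambda>s. \<Sum>n\<in>X. f n s)"
        by (intro continuous_on_sum holomorphic_on_imp_continuous_on holomorphic_on_subset [OF holo] r)
           (use X in auto)
      fix w assume w: "w \<in> ball s r"
      show "((\<lambda>s. \<Sum>n\<in>X. f n s) has_field_derivative (\<Sum>n\<in>X. deriv (f n) w)) (at w)"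
        using X w sub
        by (intro DERIV_sum holomorphic_derivI [OF holo open_halfspace_Re_gt]) auto
    qed
    then show "\<forall>\<^sub>F X in finite_subsets_at_top (multi_indices m).
        continuous_on (cball s r) (\<lambda>s. \<Sum>n\<in>X. f n s) \<and>
          (\<forall>w\<in>ball s r. ((\<lambda>s. \<Sum>n\<in>X. f n s) has_field_derivative (\<Sum>n\<in>X. deriv (f n) w)) (at w))"
      by (intro eventually_finite_subsets_at_top_weakI) auto
  qed (use r in auto)
  show ?thesis
    using g' [of s] r that by (auto simp: has_sum_def)
qed

lemma lattice_series_holomorphic:
  "(\<lambda>s. \<Sum>\<^sub>\<infinity>n\<in>multi_indices m. f n s) holomorphic_on {s. real m - e < Re s}"
  unfolding holomorphic_on_open [OF open_halfspace_Re_gt]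
  by (metis lattice_series_has_derivative mem_Collect_eq)

end

section \<open>Differences along the lattice\<close>

lemma has_sum_finite_sum:
  fixes g :: "'a \<Rightarrow> 'b \<Rightarrow> 'c::topological_comm_monoid_add"
  assumes "\<And>i. i \<in> I \<Longrightarrow> (g i has_sum S i) A"
  shows "((\<lambda>x. \<Sum>i\<in>I. g i x) has_sum (\<Sum>i\<in>I. S i)) A"
  using assms
  by (induction I rule: infinite_finite_induct) (auto intro: has_sum_add)

lemma lattice_shift_incr:
  assumes "I \<subseteq> {1..m}"
  shows "lattice_shift m a (\<lambda>i. if i \<in> I then Suc (n i) else n i) = lattice_shift m a n + sum a I"
proof -
  have "lattice_shift m a (\<lambda>i. if i \<in> I then Suc (n i) else n i) =
          (\<Sum>i=1..m. real (n i) * a i + (if i \<in> I then a i else 0))"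
    unfolding lattice_shift_def by (intro sum.cong) (auto simp: algebra_simps)
  also have "\<dots> = lattice_shift m a n + sum a I"
    using assms by (simp add: sum.distrib lattice_shift_def sum.inter_restrict [symmetric] Int_absorb1)
  finally show ?thesis .
qed

text \<open>Adding \<open>sum a I\<close> amounts to incrementing the coordinates in
  \<open>I\<close>, a bijection from all indices onto those that vanish nowhere on
  \<open>I\<close>.\<close>

lemma has_sum_lattice_incr:
  fixes f :: "real \<Rightarrow> complex"
  assumes "I \<subseteq> {1..m}"
    and "((\<lambda>n. f (w + lattice_shift m a n)) has_sum T) {n \<in> multi_indices m. \<forall>i\<in>I. n i \<noteq> 0}"
  shows "((\<lambda>n. f (w + lattice_shift m a n + sum a I)) has_sum T) (multi_indices m)"
  using assms(2)
proof (rule has_sum_reindex_bij_witness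
    \<comment> \<open>The truncated subtraction \<open>n i - 1\<close> is a true inverse because
      \<open>n i \<noteq> 0\<close> for \<open>i \<in> I\<close>.\<close>
    [where i = "\<lambda>n i. if i \<in> I then Suc (n i) else n i" and j = "\<lambda>n i. if i \<in> I then n i - 1 else n i",
        THEN iffD1, rotated -1])
  fix n assume "n \<in> multi_indices m"
  then show "(\<lambda>i. if i \<in> I then Suc (n i) else n i) \<in> {n \<in> multi_indices m. \<forall>i\<in>I. n i \<noteq> 0}"
    using assms(1) by (auto simp: multi_indices_def PiE_def extensional_def)
next
  fix n assume n: "n \<in> {n \<in> multi_indices m. \<forall>i\<in>I. n i \<noteq> 0}"
  then show "(\<lambda>i. if i \<in> I then n i - 1 else n i) \<in> multi_indices m"
    using assms(1) by (auto simp: multi_indices_def PiE_def extensional_def)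
  show eq: "(\<lambda>i. if i \<in> I then Suc (if i \<in> I then n i - 1 else n i)
             else if i \<in> I then n i - 1 else n i) = n"
    using n by (auto simp: fun_eq_iff)
  show "f (w + lattice_shift m a (\<lambda>i. if i \<in> I then n i - 1 else n i) + sum a I) = f (w + lattice_shift m a n)"
    using lattice_shift_incr [OF assms(1), of a "\<lambda>i. if i \<in> I then n i - 1 else n i"] eq
    by (simp add: add.assoc)
qed auto

text \<open>
  Shifting by \<open>I\<close> restricts the sum to the indices that do not vanish on \<open>I\<close>, so by inclusion-exclusion
  only the zero index survives.
\<close>

lemma has_sum_lattice_alternating:
  fixes f :: "real \<Rightarrow> complex"
  assumes f: "(\<lambda>n. f (w + lattice_shift m a n)) summable_on multi_indices m"
  shows "((\<lambda>n. \<Sum>I\<in>Pow {1..m}. (-1) ^ card I * f (w + lattice_shift m a n + sum a I)) has_sum f w)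
           (multi_indices m)"
proof -
  define g where "g = (\<lambda>n. f (w + lattice_shift m a n))"
  define T where "T = (\<lambda>I. \<Sum>\<^sub>\<infinity>n\<in>{n \<in> multi_indices m. \<forall>i\<in>I. n i \<noteq> 0}. g n)"
  have T: "(g has_sum T I) {n \<in> multi_indices m. \<forall>i\<in>I. n i \<noteq> 0}" for I
    unfolding T_def g_def by (intro has_sum_infsum summable_on_subset_banach [OF f]) auto
  have "((\<lambda>n. if \<forall>i\<in>I. n i \<noteq> 0 then g n else 0) has_sum T I) (multi_indices m)" for I
    using T [of I] by (rule has_sum_cong_neutral [THEN iffD1, rotated -1]) auto
  then have "((\<lambda>n. \<Sum>I\<in>Pow {1..m}. (-1) ^ card I * (if \<forall>i\<in>I. n i \<noteq> 0 then g n else 0)) has_sum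
               (\<Sum>I\<in>Pow {1..m}. (-1) ^ card I * T I)) (multi_indices m)"
    by (intro has_sum_finite_sum has_sum_cmult_right)
  moreover have "((\<lambda>n. \<Sum>I\<in>Pow {1..m}. (-1) ^ card I * (if \<forall>i\<in>I. n i \<noteq> 0 then g n else 0)) has_sum f w)
                   (multi_indices m)"
  proof -
    \<comment> \<open>Elements of \<open>multi_indices m\<close> are \<open>undefined\<close>
      outside \<open>{1..m}\<close>, so the zero index must be a restricted function.\<close>
    define n0 where "n0 = (\<lambda>i\<in>{1..m}. 0::nat)"
    have inner: "(\<Sum>I\<in>Pow {1..m}. (-1) ^ card I * (if \<forall>i\<in>I. n i \<noteq> 0 then g n else 0)) =
            (if n = n0 then g n else 0)" if n: "n \<in> multi_indices m" for n
    proof -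
      define Z where "Z = {i \<in> {1..m}. n i \<noteq> 0}"
      have "finite Z" by (simp add: Z_def)
      have "(\<Sum>I\<in>Pow {1..m}. (-1) ^ card I * (if \<forall>i\<in>I. n i \<noteq> 0 then g n else 0)) =
            (\<Sum>I\<in>Pow Z. (-1) ^ card I * g n)"
        by (rule sum.mono_neutral_cong_right) (auto simp: Z_def)
      \<comment> \<open>The signs alone are brought into the shape of
        \<open>alternating_subset_sum_power\<close> with exponent 0 and zero increments; their sum
        vanishes unless \<open>Z\<close> is empty.\<close>
      also have "\<dots> = (\<Sum>I\<in>Pow Z. (-1) ^ card I * (0 + sum (\<lambda>_. 0) I) ^ 0) * g n"
        by (simp add: sum_distrib_right)
      also have "\<dots> = (if Z = {} then g n else 0)"
        by (subst alternating_subset_sum_power) (auto simp: \<open>finite Z\<close>)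
      also have "Z = {} \<longleftrightarrow> n = n0"
        using n by (auto simp: Z_def n0_def multi_indices_def PiE_def extensional_def fun_eq_iff)
      finally show ?thesis .
    qed
    have n0: "n0 \<in> multi_indices m" "g n0 = f w"
      by (auto simp: n0_def multi_indices_def g_def lattice_shift_def)
    show ?thesis
      by (rule has_sum_finite_neutralI [where B = "{n0}"]) (use n0 inner in auto)
  qed
  ultimately have "(\<Sum>I\<in>Pow {1..m}. (-1) ^ card I * T I) = f w"
    by (rule has_sum_unique)
  moreover have "((\<lambda>n. \<Sum>I\<in>Pow {1..m}. (-1) ^ card I * f (w + lattice_shift m a n + sum a I)) has_sum
             (\<Sum>I\<in>Pow {1..m}. (-1) ^ card I * T I)) (multi_indices m)"
    using T by (intro has_sum_finite_sum has_sum_cmult_right has_sum_lattice_incr) (auto simp: g_def)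
  ultimately show ?thesis by simp
qed

text \<open>Shifting by \<open>a (Suc m)\<close> removes the layer \<open>n (Suc m) = 0\<close> from
  the sum. The difference of the two sums is therefore the sum over that layer, which is a copy of
  the lattice of dimension \<open>m\<close>.\<close>

lemma has_sum_lattice_Suc:
  fixes f :: "real \<Rightarrow> complex"
  assumes "((\<lambda>n. f (w + lattice_shift (Suc m) a n)) has_sum S) (multi_indices (Suc m))"
    and "((\<lambda>n. f (w + a (Suc m) + lattice_shift (Suc m) a n)) has_sum T) (multi_indices (Suc m))"
  shows "((\<lambda>n. f (w + lattice_shift m a n)) has_sum (S - T)) (multi_indices m)"
proof -
  define g where "g = (\<lambda>n. f (w + lattice_shift (Suc m) a n))"
  define A where "A = {n \<in> multi_indices (Suc m). \<forall>i\<in>{Suc m}. n i \<noteq> 0}"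
  define B where "B = {n \<in> multi_indices (Suc m). n (Suc m) = 0}"
  have un: "multi_indices (Suc m) = A \<union> B" "A \<inter> B = {}"
    by (auto simp: A_def B_def)
  have g: "g summable_on multi_indices (Suc m)"
    using assms(1) by (auto simp: g_def summable_on_def)
  have A: "(g has_sum infsum g A) A" and B: "(g has_sum infsum g B) B"
    by (intro has_sum_infsum summable_on_subset_banach [OF g]; auto simp: A_def B_def)+
  have "(g has_sum infsum g A + infsum g B) (multi_indices (Suc m))"
    unfolding un(1) by (rule has_sum_Un_disjoint [OF A B un(2)])
  then have "infsum g A + infsum g B = S"
    using assms(1) unfolding g_def by (rule has_sum_unique)
  moreover have "infsum g A = T"
    using has_sum_lattice_incr [of "{Suc m}" "Suc m" f w a "infsum g A"] A assms(2)
    by (auto simp: g_def A_def add_ac dest: has_sum_unique)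
  ultimately have "(g has_sum (S - T)) B"
    using B by (metis add_diff_cancel_left')
  then show ?thesis
  proof (rule has_sum_reindex_bij_witness
      \<comment> \<open>The layer and the smaller lattice differ only in the value at
        \<open>Suc m\<close>, which is 0 in the former and \<open>undefined\<close> in the
        latter.\<close>
      [where i = "\<lambda>n. n(Suc m := 0)" and j = "\<lambda>n. n(Suc m := undefined)", THEN iffD1, rotated -1])
    fix n assume n: "n \<in> multi_indices m"
    then show "(n(Suc m := 0))(Suc m := undefined) = n" "n(Suc m := 0) \<in> B"
      by (auto simp: multi_indices_def B_def PiE_def extensional_def fun_eq_iff)
  next
    fix n assume n: "n \<in> B"
    then show "(n(Suc m := undefined))(Suc m := 0) = n" "n(Suc m := undefined) \<in> multi_indices m"
      by (auto simp: multi_indices_def B_def PiE_def extensional_def fun_eq_iff)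
    show "f (w + lattice_shift m a (n(Suc m := undefined))) = g n"
      using n by (simp add: g_def lattice_shift_def B_def)
  qed simp
qed

section \<open>Analytic continuation of the Barnes zeta function\<close>

text \<open>By the identity theorem on the connected plane, \<open>f - g\<close> vanishes near every
  point, apart from the point itself. The value there is then forced as well: 0 at a pole, the limit
  elsewhere. This gives the uniqueness behind the definite description in
  \<open>barnes_zeta\<close>.\<close>

lemma nicely_meromorphic_eqI:
  assumes f: "f nicely_meromorphic_on UNIV" and g: "g nicely_meromorphic_on UNIV"
    and eq: "\<forall>\<^sub>F s in at z0. f s = g s"
  shows "f = g"
proof
  fix z
  have "(\<lambda>s. f s - g s) meromorphic_on UNIV"
    using f g by (intro meromorphic_intros) (auto simp: nicely_meromorphic_on_def)
  from meromorphic_imp_constant_or_avoid [OF this open_UNIV connected_UNIV, of 0]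
  have "\<forall>\<^sub>F s in cosparse UNIV. f s - g s = 0"
  proof
    assume "\<forall>\<^sub>F s in cosparse UNIV. f s - g s \<noteq> 0"
    then have "\<forall>\<^sub>F s in at z0. f s - g s \<noteq> 0"
      by (simp add: eventually_cosparse_open_eq)
    with eq have "\<forall>\<^sub>F s in at z0. False"
      by eventually_elim auto
    then show ?thesis by simp
  qed
  then have ev: "\<forall>\<^sub>F s in at z. f s = g s"
    by (simp add: eventually_cosparse_open_eq)
  then have pole: "is_pole f z \<longleftrightarrow> is_pole g z" and lim: "f \<midarrow>z\<rightarrow> c \<longleftrightarrow> g \<midarrow>z\<rightarrow> c" for c
    by (intro is_pole_cong tendsto_cong; simp)+
  have no_lim: "\<not> g \<midarrow>z\<rightarrow> c" if "is_pole g z" for c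
    using that not_tendsto_and_filterlim_at_infinity [of "at z" g c] by (auto simp: is_pole_def)
  have "(is_pole f z \<and> f z = 0) \<or> f \<midarrow>z\<rightarrow> f z" "(is_pole g z \<and> g z = 0) \<or> g \<midarrow>z\<rightarrow> g z"
    using f g by (auto simp: nicely_meromorphic_on_def)
  then show "f z = g z"
    using pole lim no_lim LIM_unique by metis
qed

text \<open>The product is (s-1)(s-2)...(s-M), the factor that clears the possible poles of the zeta
  function.\<close>

lemma pochhammer_shifted_nonzero:
  assumes "s \<notin> of_nat ` {1..M}"
  shows "pochhammer (s - of_nat M :: complex) M \<noteq> 0"
proof
  assume "pochhammer (s - of_nat M) M = 0"
  then obtain k where k: "k < M" "s - of_nat M = - of_nat k"
    by (auto simp: pochhammer_eq_0_iff)
  then have "s = of_nat (M - k)"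
    by (simp add: of_nat_diff algebra_simps)
  moreover have "M - k \<in> {1..M}"
    using k by auto
  ultimately show False
    using assms by blast
qed

section \<open>Continuation in \<open>s\<close> for fixed real \<open>w > 0\<close>\<close>

context
  fixes M :: nat and a :: "nat \<Rightarrow> real" and w :: real
  assumes M: "1 \<le> M" and a: "\<And>i. i \<in> {1..M} \<Longrightarrow> 0 < a i" and w: "0 < w"
begin

lemma lattice_point_pos: "0 < w + lattice_shift M a n"
  using lattice_shift_nonneg [of M a n] a w by simp

lemma has_sum_barnes_series:
  assumes "real M < Re s"
  shows "((\<lambda>n. of_real (w + lattice_shift M a n) powr (- s)) has_sum barnes_series M a (of_real w) s)
           (multi_indices M)"
proof -
  have "(\<lambda>n. cmod (of_real (w + lattice_shift M a n) powr (- s))) summable_on multi_indices M"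
    using summable_on_lattice_powr [OF a w assms] lattice_point_pos
    by (simp add: norm_powr_real_powr order.strict_implies_order del: of_real_add)
  then have "(\<lambda>n. of_real (w + lattice_shift M a n) powr (- s)) summable_on multi_indices M"
    by (rule abs_summable_summable)
  then show ?thesis
    by (simp add: barnes_series_def lattice_shift_def)
qed

lemma barnes_series_holomorphic: "barnes_series M a (of_real w) holomorphic_on {s. real M < Re s}"
proof -
  have "(\<lambda>s. \<Sum>\<^sub>\<infinity>n\<in>multi_indices M. of_real (w + lattice_shift M a n) powr (- s)) holomorphic_on
          {s. real M - 0 < Re s}"
  proof (rule lattice_series_holomorphic [where C = "\<lambda>_. 1", OF a w])
    fix n s
    show "cmod (of_real (w + lattice_shift M a n) powr (- s)) \<le> 1 * (w + lattice_shift M a n) powr (- (Re s + 0))"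
      using lattice_point_pos [of n] by (simp add: norm_powr_real_powr del: of_real_add)
    show "(\<lambda>s. of_real (w + lattice_shift M a n) powr (- s)) holomorphic_on {s. real M - 0 < Re s}"
      using lattice_point_pos [of n] by (intro holomorphic_intros) (auto simp del: of_real_add)
  qed auto
  then show ?thesis
    by (simp add: barnes_series_def [abs_def] lattice_shift_def)
qed

text \<open>The telescoped expansion is a linear relation between \<open>H s\<close>, the values
  \<open>H (s + of_nat j)\<close> for \<open>1 \<le> j \<le> K\<close>, and a remainder. Shifting by
  \<open>j \<ge> 1\<close> puts these values into the half-plane already reached whenever
  \<open>Re s > M - K - 1\<close>, so solving for \<open>H s\<close> gains one strip.\<close>

lemma barnes_continuation_step:
  assumes holo: "H holomorphic_on {s. real M - real K < Re s}"
    and H: "\<And>s. real M < Re s \<Longrightarrow> H s = pochhammer (s - of_nat M) M * barnes_series M a (of_real w) s"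
  obtains H' where "H' holomorphic_on {s. real M - real (Suc K) < Re s}"
    and "\<And>s. real M < Re s \<Longrightarrow> H' s = pochhammer (s - of_nat M) M * barnes_series M a (of_real w) s"
proof -
  \<comment> \<open>Expanding \<open>x powr (M - s)\<close> to order \<open>L\<close> leaves a
    remainder of size \<open>x powr (- (Re s + K + 1))\<close>, summable over the lattice for
    \<open>Re s > M - K - 1\<close>.\<close>
  define L where "L = M + Suc K"
  define D where "D = (\<lambda>p. \<Sum>J\<in>Pow {1..M}. (-1) ^ card J * of_real (sum a J) ^ p :: complex)"
  define \<kappa> where "\<kappa> = (\<lambda>p. (-1) ^ p / fact p * D p)"
  define y where "y = (\<lambda>n. w + lattice_shift M a n)"
  have y: "0 < y n" for n
    using lattice_point_pos by (simp add: y_def)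
  have D_M: "D M = (-1) ^ M * fact M * (\<Prod>i=1..M. of_real (a i))"
    using alternating_subset_sum_power [of "{1..M}" M 0 "\<lambda>i. of_real (a i) :: complex"]
    by (simp add: D_def)
  \<comment> \<open>The leading coefficient is the covolume of the lattice: sign and factorial
    cancel, so it is safe to divide by it.\<close>
  have "\<kappa> M = (\<Prod>i=1..M. of_real (a i))"
    by (simp add: \<kappa>_def D_M power_mult_distrib [symmetric])
  then have \<kappa>_M: "\<kappa> M \<noteq> 0"
    using a by fastforce
  define R where "R = (\<lambda>n s. (\<Sum>J\<in>Pow {1..M}. (-1) ^ card J * of_real (y n + sum a J) powr (of_nat M - s)) -
      (\<Sum>p=M..<L. \<kappa> p * pochhammer (s - of_nat M) p * of_real (y n) powr (of_nat M - s - of_nat p)))"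
  define RS where "RS = (\<lambda>s. \<Sum>\<^sub>\<infinity>n\<in>multi_indices M. R n s)"
  have bound: "cmod (R n s) \<le> cmod (pochhammer (s - of_nat M) L) * (\<Sum>J\<in>Pow {1..M}. sum a J ^ L) / fact (L - 1)
                 * (w + lattice_shift M a n) powr (- (Re s + real (Suc K)))"
    if "real M - real (Suc K) < Re s" for n s
    using alternating_powr_bound [of "{1..M}" a "y n" L "of_nat M - s"] y [of n] that a
    by (simp add: R_def y_def \<kappa>_def D_def L_def less_imp_le algebra_simps)
  have R_holo: "R n holomorphic_on A" for n A
  proof -
    have "0 < y n + sum a J" if "J \<subseteq> {1..M}" for J
      using y [of n] that by (intro add_pos_nonneg sum_nonneg) (auto intro!: less_imp_le [OF a])
    then show ?thesis
      unfolding R_def using y [of n] by (intro holomorphic_intros) (auto simp del: of_real_add)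
  qed
  have C_cont: "continuous_on A (\<lambda>s. cmod (pochhammer (s - of_nat M) L) * (\<Sum>J\<in>Pow {1..M}. sum a J ^ L) / fact (L - 1))" for A
    by (intro continuous_intros holomorphic_on_imp_continuous_on holomorphic_intros) auto
  have RS_holo: "RS holomorphic_on {s. real M - real (Suc K) < Re s}"
    unfolding RS_def by (rule lattice_series_holomorphic [OF a w R_holo C_cont bound])
  have R_sum: "(\<lambda>n. R n s) summable_on multi_indices M" if "real M - real (Suc K) < Re s" for s
    by (rule lattice_series_summable [OF a w R_holo C_cont bound that])
  define H' where "H' = (\<lambda>s. (of_real w powr (of_nat M - s) - RS s -
      (\<Sum>j=1..K. \<kappa> (M + j) * pochhammer (s - of_nat M) j * H (s + of_nat j))) / \<kappa> M)"
  have H'_holo: "H' holomorphic_on {s. real M - real (Suc K) < Re s}"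
  proof -
    have "(\<lambda>s. H (s + of_nat j)) holomorphic_on {s. real M - real (Suc K) < Re s}" if "j \<in> {1..K}" for j
      using that by (intro holomorphic_on_compose_gen [OF _ holo, unfolded o_def] holomorphic_intros) auto
    then show ?thesis
      unfolding H'_def using \<kappa>_M w by (intro holomorphic_intros RS_holo) auto
  qed
  \<comment> \<open>The telescoping identity itself needs \<open>x powr (M - s)\<close> to be summable over the lattice.\<close>
  have H'_eq: "H' s = H s" if s: "2 * real M < Re s" for s
  proof -
    have s': "real M < Re s" using s by linarith
    have "of_real w powr (of_nat M - s) = RS s + (\<Sum>p=M..<L. \<kappa> p * pochhammer (s - of_nat M) p *
              barnes_series M a (of_real w) (s + of_nat (p - M)))"
    proof (rule has_sum_unique)
      have "(\<lambda>n. of_real (w + lattice_shift M a n) powr (of_nat M - s)) summable_on multi_indices M"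
        using has_sum_barnes_series [of "s - of_nat M"] s by (auto simp: summable_on_def)
      from has_sum_lattice_alternating [OF this]
      show "((\<lambda>n. \<Sum>J\<in>Pow {1..M}. (-1) ^ card J * of_real (y n + sum a J) powr (of_nat M - s)) has_sum
              of_real w powr (of_nat M - s)) (multi_indices M)"
        by (simp add: y_def)
      have "((\<lambda>n. R n s) has_sum RS s) (multi_indices M)"
        unfolding RS_def using s' by (intro has_sum_infsum R_sum) auto
      moreover have "((\<lambda>n. \<Sum>p=M..<L. \<kappa> p * pochhammer (s - of_nat M) p * of_real (y n) powr (of_nat M - s - of_nat p)) has_sum
          (\<Sum>p=M..<L. \<kappa> p * pochhammer (s - of_nat M) p * barnes_series M a (of_real w) (s + of_nat (p - M))))
          (multi_indices M)"
      proof (intro has_sum_finite_sum has_sum_cmult_right)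
        fix p assume p: "p \<in> {M..<L}"
        then have eq: "of_nat M - s - of_nat p = - (s + of_nat (p - M))"
          by (simp add: of_nat_diff)
        show "((\<lambda>n. of_real (y n) powr (of_nat M - s - of_nat p)) has_sum
            barnes_series M a (of_real w) (s + of_nat (p - M))) (multi_indices M)"
          unfolding eq y_def by (rule has_sum_barnes_series) (use s' in simp)
      qed
      ultimately show "((\<lambda>n. \<Sum>J\<in>Pow {1..M}. (-1) ^ card J * of_real (y n + sum a J) powr (of_nat M - s)) has_sum
          RS s + (\<Sum>p=M..<L. \<kappa> p * pochhammer (s - of_nat M) p *
              barnes_series M a (of_real w) (s + of_nat (p - M)))) (multi_indices M)"
        using has_sum_add by (fastforce simp: R_def)
    qed
    also have "(\<Sum>p=M..<L. \<kappa> p * pochhammer (s - of_nat M) p * barnes_series M a (of_real w) (s + of_nat (p - M)))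
             = (\<Sum>j=0..<Suc K. \<kappa> (M + j) * pochhammer (s - of_nat M) j * H (s + of_nat j))"
    proof (rule sum.reindex_bij_witness [of _ "\<lambda>j. M + j" "\<lambda>p. p - M"])
      \<comment> \<open>With j = p - M, the last \<open>M\<close> factors of
        \<open>pochhammer (s - of_nat M) p\<close> are exactly the clearing factor at
        \<open>s + j\<close>, which turns the zeta value there into
        \<open>H (s + j)\<close>.\<close>
      fix p assume p: "p \<in> {M..<L}"
      have "pochhammer (s - of_nat M) p =
              pochhammer (s - of_nat M) (p - M) * pochhammer (s + of_nat (p - M) - of_nat M) M"
        using p pochhammer_product' [of "s - of_nat M" "p - M" M] by (simp add: algebra_simps)
      then show "\<kappa> (M + (p - M)) * pochhammer (s - of_nat M) (p - M) * H (s + of_nat (p - M)) =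
          \<kappa> p * pochhammer (s - of_nat M) p * barnes_series M a (of_real w) (s + of_nat (p - M))"
        using p s' by (simp add: H)
    qed (auto simp: L_def)
    also have "\<dots> = \<kappa> M * H s + (\<Sum>j=1..K. \<kappa> (M + j) * pochhammer (s - of_nat M) j * H (s + of_nat j))"
      by (simp add: sum.atLeast_Suc_atMost atLeastLessThanSuc_atLeastAtMost)
    finally show ?thesis
      using \<kappa>_M by (simp add: H'_def)
  qed
  \<comment> \<open>The identity theorem extends the agreement from \<open>Re s > 2 * M\<close> to
    the half-plane where the series is defined.\<close>
  have "H' s = H s" if "real M < Re s" for s
  proof (rule analytic_continuation_open [of "{s. 2 * real M < Re s}" "{s. real M < Re s}" H' H])
    show "{s. 2 * real M < Re s} \<noteq> {}"
      by (auto intro: exI [of _ "of_real (2 * real M + 1)"])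
    show "connected {s. real M < Re s}"
      by (intro convex_connected convex_halfspace_Re_gt)
    show "H' holomorphic_on {s. real M < Re s}" "H holomorphic_on {s. real M < Re s}"
      by (rule holomorphic_on_subset [OF H'_holo] holomorphic_on_subset [OF holo]; force)+
  qed (use H'_eq that in \<open>auto intro: open_halfspace_Re_gt\<close>)
  with H H'_holo show ?thesis
    by (intro that [of H']) auto
qed

lemma barnes_continuation_halfplane:
  "\<exists>H. H holomorphic_on {s. real M - real K < Re s} \<and>
     (\<forall>s. real M < Re s \<longrightarrow> H s = pochhammer (s - of_nat M) M * barnes_series M a (of_real w) s)"
proof (induction K)
  case 0
  then show ?case
    by (intro exI [of _ "\<lambda>s. pochhammer (s - of_nat M) M * barnes_series M a (of_real w) s"] conjI
        holomorphic_intros barnes_series_holomorphic) (auto intro: barnes_series_holomorphic)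
next
  case (Suc K)
  then obtain H where "H holomorphic_on {s. real M - real K < Re s}"
    "\<And>s. real M < Re s \<Longrightarrow> H s = pochhammer (s - of_nat M) M * barnes_series M a (of_real w) s"
    by blast
  from barnes_continuation_step [OF this] show ?case
    by metis
qed

text \<open>The extensions to the various half-planes coincide on overlaps, as all of them extend
  the same function on \<open>Re s > M\<close>, so they glue.\<close>

lemma barnes_continuation_entire:
  obtains H where "H holomorphic_on UNIV"
    and "\<And>s. real M < Re s \<Longrightarrow> H s = pochhammer (s - of_nat M) M * barnes_series M a (of_real w) s"
proof -
  obtain h where holo: "\<And>K. h K holomorphic_on {s. real M - real K < Re s}"
    and h: "\<And>K s. real M < Re s \<Longrightarrow> h K s = pochhammer (s - of_nat M) M * barnes_series M a (of_real w) s"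
    using barnes_continuation_halfplane by metis
  have h_mono: "h K s = h K' s" if "K \<le> K'" "real M - real K < Re s" for K K' s
  proof (rule analytic_continuation_open
      [of "{s. real M < Re s}" "{s. real M - real K < Re s}" "h K" "h K'"])
    show "{s. real M < Re s} \<noteq> {}"
      by (auto intro: exI [of _ "of_real (real M + 1)"])
    show "connected {s. real M - real K < Re s}"
      by (intro convex_connected convex_halfspace_Re_gt)
    show "h K' holomorphic_on {s. real M - real K < Re s}"
      using that by (intro holomorphic_on_subset [OF holo]) auto
    show "h K s = h K' s" if "s \<in> {s. real M < Re s}" for s
      using that by (simp add: h)
  qed (use that(2) in \<open>auto intro: open_halfspace_Re_gt holo\<close>)
  have h_eq: "h K s = h K' s" if "real M - real K < Re s" "real M - real K' < Re s" for K K' s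
    using h_mono [of K K' s] h_mono [of K' K s] that nat_le_linear [of K K'] by metis
  \<comment> \<open>The summand 1 makes the inequality strict, so that \<open>s\<close> lies in the
    open half-plane with index \<open>k s\<close>.\<close>
  define k where "k = (\<lambda>s. nat \<lceil>real M - Re s\<rceil> + 1)"
  have k: "real M - real (k s) < Re s" for s
    unfolding k_def by linarith
  define H where "H = (\<lambda>s. h (k s) s)"
  show ?thesis
  proof
    show "H holomorphic_on UNIV"
    proof (rule holomorphic_on_subset [OF holomorphic_on_UN_open])
      fix K :: nat assume "K \<in> UNIV"
      show "H holomorphic_on {s. real M - real K < Re s}"
        using holo by (rule holomorphic_transform) (use k in \<open>auto simp: H_def intro: h_eq\<close>)
      show "open {s. real M - real K < Re s}"
        by (rule open_halfspace_Re_gt)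
    next
      show "UNIV \<subseteq> (\<Union>K\<in>UNIV. {s. real M - real K < Re s})"
        using k by blast
    qed
    show "H s = pochhammer (s - of_nat M) M * barnes_series M a (of_real w) s" if "real M < Re s" for s
      using that h by (simp add: H_def)
  qed
qed

text \<open>This unfolds the definite description: the quotient of \<open>H\<close> by the clearing
  factor, once its singularities are normalised, satisfies the defining property, and
  \<open>nicely_meromorphic_eqI\<close> makes it the only such function. The formula holds away from
  1, ..., M, in particular near 0.\<close>

lemma barnes_zeta_eq:
  obtains H where "H holomorphic_on UNIV"
    and "\<And>s. real M < Re s \<Longrightarrow> H s = pochhammer (s - of_nat M) M * barnes_series M a (of_real w) s"
    and "\<And>s. s \<notin> of_nat ` {1..M} \<Longrightarrow> barnes_zeta M a (of_real w) s = H s / pochhammer (s - of_nat M) M"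
proof -
  obtain H where holo: "H holomorphic_on UNIV"
    and H: "\<And>s. real M < Re s \<Longrightarrow> H s = pochhammer (s - of_nat M) M * barnes_series M a (of_real w) s"
    using barnes_continuation_entire by blast
  define Q where "Q = (\<lambda>s. H s / pochhammer (s - of_nat M) M)"
  \<comment> \<open>\<open>H\<close> may vanish at some of the points 1, ..., M, which makes the
    singularity there removable; \<open>remove_sings\<close> fills in the limit at such points and 0
    at true poles.\<close>
  define Z where "Z = remove_sings Q"
  have right: "s \<notin> of_nat ` {1..M}" if "real M < Re s" for s
    using that by auto
  have Z_eq: "Z s = H s / pochhammer (s - of_nat M) M" if s: "s \<notin> of_nat ` {1..M}" for s
  proof -
    have "open (- of_nat ` {1..M} :: complex set)"
      by (intro open_Compl finite_imp_closed) auto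
    moreover have "Q holomorphic_on - of_nat ` {1..M}"
      unfolding Q_def using pochhammer_shifted_nonzero
      by (intro holomorphic_intros holomorphic_on_subset [OF holo]) auto
    ultimately have "Q analytic_on {s}"
      using s by (auto simp: analytic_at)
    then show ?thesis
      by (simp add: Z_def Q_def)
  qed
  have "Q meromorphic_on UNIV"
    unfolding Q_def
    by (intro meromorphic_intros analytic_on_imp_meromorphic_on)
       (auto simp: analytic_on_open holo intro!: holomorphic_intros)
  then have Z: "Z nicely_meromorphic_on UNIV"
    unfolding Z_def by (rule remove_sings_nicely_meromorphic)
  have Z_series: "Z s = barnes_series M a (of_real w) s" if "real M < Re s" for s
    using Z_eq [OF right [OF that]] H [OF that] pochhammer_shifted_nonzero [OF right [OF that]] by simp
  have "barnes_zeta M a (of_real w) = Z"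
    unfolding barnes_zeta_def
  proof (rule the_equality)
    show "Z nicely_meromorphic_on UNIV \<and> (\<forall>s. real M < Re s \<longrightarrow> Z s = barnes_series M a (of_real w) s)"
      using Z Z_series by auto
  next
    fix f assume f: "f nicely_meromorphic_on UNIV \<and> (\<forall>s. real M < Re s \<longrightarrow> f s = barnes_series M a (of_real w) s)"
    have "open {s. real M < Re s}" "of_real (real M + 1) \<in> {s. real M < Re s}"
      by (simp_all add: open_halfspace_Re_gt)
    then have "\<forall>\<^sub>F s in at (of_real (real M + 1)). s \<in> {s. real M < Re s}"
      by (rule eventually_at_in_open')
    then have "\<forall>\<^sub>F s in at (of_real (real M + 1)). f s = Z s"
      by eventually_elim (use f Z_series in auto)
    then show "f = Z"
      using f Z nicely_meromorphic_eqI by blast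
  qed
  then show ?thesis
    using Z_eq by (intro that [OF holo H]) auto
qed

end

section \<open>The Mellin transform at multiples of the last parameter\<close>

lemma has_uncond_prod_unique:
  assumes "has_uncond_prod f p A" "has_uncond_prod f q A"
  shows "p = q"
  using assms tendsto_unique [OF finite_subsets_at_top_neq_bot] by (auto simp: has_uncond_prod_def)

lemma uncond_prod_eqI: "has_uncond_prod f p A \<Longrightarrow> uncond_prod f A = p"
  unfolding uncond_prod_def using has_uncond_prod_unique by blast

lemma has_uncond_prod_exp:
  assumes f: "(f has_sum S) A"
  shows "has_uncond_prod (\<lambda>x. exp (f x)) (exp S) A"
proof -
  have "((\<lambda>F. exp (sum f F)) \<longlongrightarrow> exp S) (finite_subsets_at_top A)"
    using f by (intro tendsto_exp) (simp add: has_sum_def)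
  then have "((\<lambda>F. \<Prod>x\<in>F. exp (f x)) \<longlongrightarrow> exp S) (finite_subsets_at_top A)"
    by (rule Lim_transform_eventually)
       (intro eventually_finite_subsets_at_top_weakI, simp add: exp_sum)
  then show ?thesis
    by (simp add: has_uncond_prod_def)
qed

text \<open>All factors are positive, so the bracket has a real logarithm. It is minus the
  derivative at \<open>s = 0\<close> of the alternating sum of the powers
  \<open>(x + sum b J) powr (- s)\<close>.\<close>

lemma barnes_bracket_eq_exp:
  assumes b: "\<And>j. j \<in> {1..N} \<Longrightarrow> 0 < b j" and x: "0 < x"
  shows "barnes_bracket N b x = exp (\<Sum>J\<in>Pow {1..N}. (-1) ^ card J * ln (x + sum b J))"
proof -
  have "(x + sum b J) powi ((-1) ^ card J) = exp ((-1) ^ card J * ln (x + sum b J))"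
    if "J \<in> Pow {1..N}" for J
  proof -
    have "0 < x + sum b J"
      using x that by (intro add_pos_nonneg sum_nonneg) (auto intro!: less_imp_le [OF b])
    then show ?thesis
      by (cases "even (card J)") (auto simp: exp_minus power_int_minus)
  qed
  then show ?thesis
    unfolding barnes_bracket_def exp_sum [OF finite_Pow_iff [THEN iffD2, OF finite_atLeastAtMost]]
    by (intro prod.cong) auto
qed

text \<open>The \<open>N\<close>-fold difference improves the decay by \<open>N\<close> orders, so
  the series converges for \<open>Re s > m - N\<close>, a half-plane containing 0 because
  \<open>m < N\<close>. Differentiating termwise at 0 gives minus the logarithms of the brackets;
  hence the convergence of the product and its nonzero limit \<open>exp r\<close>.\<close>

lemma alternating_lattice_series:
  fixes a b :: "nat \<Rightarrow> real"
  assumes m: "m < N" and a: "\<And>i. i \<in> {1..m} \<Longrightarrow> 0 < a i"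
    and b: "\<And>j. j \<in> {1..N} \<Longrightarrow> 0 < b j" and x: "0 < x"
  obtains G r where "G holomorphic_on {s. real m - real N < Re s}"
    and "\<And>s. real m - real N < Re s \<Longrightarrow>
           ((\<lambda>n. \<Sum>J\<in>Pow {1..N}. (-1) ^ card J * of_real (x + sum b J + lattice_shift m a n) powr (- s))
              has_sum G s) (multi_indices m)"
    and "(G has_field_derivative of_real (- r)) (at 0)"
    and "has_uncond_prod (\<lambda>n. barnes_bracket N b (x + lattice_shift m a n)) (exp r) (multi_indices m)"
proof -
  define y where "y = (\<lambda>n. x + lattice_shift m a n)"
  have y: "0 < y n" for n
    using lattice_shift_nonneg [of m a n] a x by (simp add: y_def)
  have yb: "0 < y n + sum b J" if "J \<subseteq> {1..N}" for n J
    using y [of n] that by (intro add_pos_nonneg sum_nonneg) (auto intro!: less_imp_le [OF b])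
  define g where "g = (\<lambda>n s. \<Sum>J\<in>Pow {1..N}. (-1) ^ card J * of_real (y n + sum b J) powr (- s) :: complex)"
  define G where "G = (\<lambda>s. \<Sum>\<^sub>\<infinity>n\<in>multi_indices m. g n s)"
  have g_holo: "g n holomorphic_on A" for n A
    unfolding g_def by (intro holomorphic_intros)
  have bound: "cmod (g n s) \<le> cmod (pochhammer s N) * (\<Sum>J\<in>Pow {1..N}. sum b J ^ N) / fact (N - 1)
                 * (x + lattice_shift m a n) powr (- (Re s + real N))"
    if "real m - real N < Re s" for n s
    \<comment> \<open>The order is taken equal to \<open>card {1..N}\<close>, so the correction sum
      ranges over the empty set \<open>{N..<N}\<close>.\<close>
    using alternating_powr_bound [of "{1..N}" b "y n" N "- s"] y [of n] that b m
    by (simp add: g_def y_def less_imp_le algebra_simps)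
  have C_cont: "continuous_on A (\<lambda>s. cmod (pochhammer s N) * (\<Sum>J\<in>Pow {1..N}. sum b J ^ N) / fact (N - 1))" for A
    by (intro continuous_intros holomorphic_on_imp_continuous_on holomorphic_intros) auto
  note series = a x g_holo C_cont bound
  have G_holo: "G holomorphic_on {s. real m - real N < Re s}"
    unfolding G_def by (rule lattice_series_holomorphic [OF series])
  have G_sum: "((\<lambda>n. g n s) has_sum G s) (multi_indices m)" if "real m - real N < Re s" for s
    unfolding G_def by (intro has_sum_infsum lattice_series_summable [OF series that])
  define t where "t = (\<lambda>n. \<Sum>J\<in>Pow {1..N}. (-1) ^ card J * ln (y n + sum b J))"
  have deriv_g: "deriv (g n) 0 = of_real (- t n)" for n
  proof (rule DERIV_imp_deriv)
    have "((\<lambda>s. of_real (y n + sum b J) powr (- s) :: complex) has_field_derivative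
             of_real (- ln (y n + sum b J))) (at 0)" if "J \<in> Pow {1..N}" for J
    proof -
      define c where "c = y n + sum b J"
      have "0 < c" using yb [of J n] that by (simp add: c_def)
      then have "((\<lambda>s. of_real c powr (- s)) has_field_derivative Ln (of_real c) * of_real c powr (- 0) * (- 1)) (at 0)"
        by (intro DERIV_chain' [OF _ has_field_derivative_powr_right] derivative_intros) auto
      with \<open>0 < c\<close> show ?thesis
        by (simp add: c_def [symmetric] Ln_of_real)
    qed
    then have "(g n has_field_derivative (\<Sum>J\<in>Pow {1..N}. (-1) ^ card J * of_real (- ln (y n + sum b J)))) (at 0)"
      unfolding g_def by (intro DERIV_sum DERIV_cmult)
    then show "(g n has_field_derivative of_real (- t n)) (at 0)"
      by (simp add: t_def sum_negf)
  qed
  obtain D where D: "(G has_field_derivative D) (at 0)"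
    and "((\<lambda>n. deriv (g n) 0) has_sum D) (multi_indices m)"
    using lattice_series_has_derivative [OF series, of 0] m unfolding G_def by auto
  then have D_sum: "((\<lambda>n. complex_of_real (- t n)) has_sum D) (multi_indices m)"
    by (simp only: deriv_g)
  define r where "r = - Re D"
  \<comment> \<open>The termwise derivatives are real, so their sum is real too.\<close>
  have "Im D = 0"
    using has_sum_Im [OF D_sum] has_sum_unique [OF _ has_sum_0] by fastforce
  then have D_eq: "D = of_real (- r)"
    by (simp add: r_def complex_eq_iff)
  have "(t has_sum r) (multi_indices m)"
    using has_sum_Re [OF D_sum] by (simp add: r_def has_sum_uminus)
  from has_uncond_prod_exp [OF this]
  have "has_uncond_prod (\<lambda>n. barnes_bracket N b (y n)) (exp r) (multi_indices m)"
    by (simp only: t_def barnes_bracket_eq_exp [OF b y])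
  then show ?thesis
    using that [OF G_holo _ D [unfolded D_eq]] G_sum by (simp add: g_def y_def add_ac)
qed

text \<open>Going from \<open>b 0\<close> to \<open>b 0 + k * a M\<close> in \<open>k\<close> steps
  of length \<open>a M\<close>, each step changes the differenced zeta function by one series
  \<open>G l\<close> of dimension \<open>M - 1\<close>. Comparing derivatives at 0 then turns the
  exponent of \<open>barnes_eta\<close> into the sum of the logarithms \<open>r l\<close>.\<close>

lemma barnes_eta_eq_prod:
  fixes a b :: "nat \<Rightarrow> real"
  assumes M: "1 \<le> M" "M \<le> N" and a: "\<And>i. i \<in> {1..M} \<Longrightarrow> 0 < a i"
    and b: "\<And>j. j \<in> {0..N} \<Longrightarrow> 0 < b j"
  obtains p where "barnes_eta M N a b (of_real (real k * a M)) = of_real (\<Prod>l<k. p l)"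
    and "\<And>l. has_uncond_prod (\<lambda>n. barnes_bracket N b (real l * a M + b 0 + lattice_shift (M - 1) a n))
               (p l) (multi_indices (M - 1))"
proof -
  obtain m where m: "M = Suc m" using M by (cases M) auto
  define x where "x = (\<lambda>l. real l * a M + b 0)"
  have x: "0 < x l" for l
    using a [of M] b [of 0] M by (simp add: x_def add_nonneg_pos)
  have xb: "0 < x l + sum b J" if "J \<subseteq> {1..N}" for l J
    using x [of l] that by (intro add_pos_nonneg sum_nonneg) (auto intro!: less_imp_le [OF b])
  \<comment> \<open>Packaging the conclusions into one predicate allows choosing \<open>G\<close>
    and \<open>r\<close> as functions of \<open>l\<close>; \<open>cont\<close> does the same for the
    continuation as a function of \<open>w\<close>.\<close>
  define series where "series = (\<lambda>l G r. G holomorphic_on {s. real m - real N < Re s} \<and>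
     (\<forall>s. real m - real N < Re s \<longrightarrow>
           ((\<lambda>n. \<Sum>J\<in>Pow {1..N}. (-1) ^ card J * of_real (x l + sum b J + lattice_shift m a n) powr (- s))
              has_sum G s) (multi_indices m)) \<and>
     (G has_field_derivative of_real (- r)) (at 0) \<and>
     has_uncond_prod (\<lambda>n. barnes_bracket N b (x l + lattice_shift m a n)) (exp r) (multi_indices m))"
  have "\<exists>G r. series l G r" for l
    unfolding series_def by (rule alternating_lattice_series [of m N a b "x l"]) (use a b m M x in auto)
  then obtain G r where "\<And>l. series l (G l) (r l)"
    by metis
  then have G_holo: "\<And>l. G l holomorphic_on {s. real m - real N < Re s}"
    and G_sum: "\<And>l s. real m - real N < Re s \<Longrightarrow>
           ((\<lambda>n. \<Sum>J\<in>Pow {1..N}. (-1) ^ card J * of_real (x l + sum b J + lattice_shift m a n) powr (- s))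
              has_sum G l s) (multi_indices m)"
    and G_deriv: "\<And>l. (G l has_field_derivative of_real (- r l)) (at 0)"
    and prod: "\<And>l. has_uncond_prod (\<lambda>n. barnes_bracket N b (x l + lattice_shift m a n)) (exp (r l)) (multi_indices m)"
    unfolding series_def by blast+
  define cont where "cont = (\<lambda>w H. H holomorphic_on UNIV \<and>
     (\<forall>s. real M < Re s \<longrightarrow> H s = pochhammer (s - of_nat M) M * barnes_series M a (of_real w) s) \<and>
     (\<forall>s. s \<notin> of_nat ` {1..M} \<longrightarrow> barnes_zeta M a (of_real w) s = H s / pochhammer (s - of_nat M) M))"
  have "\<exists>H. cont w H" if "0 < w" for w
    unfolding cont_def by (rule barnes_zeta_eq [OF M(1) a that]) blast+
  then obtain H where H: "\<And>w. 0 < w \<Longrightarrow> cont w (H w)"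
    by metis
  then have H_holo: "\<And>w. 0 < w \<Longrightarrow> H w holomorphic_on UNIV"
    and H_series: "\<And>w s. 0 < w \<Longrightarrow> real M < Re s \<Longrightarrow>
          H w s = pochhammer (s - of_nat M) M * barnes_series M a (of_real w) s"
    and H_zeta: "\<And>w s. 0 < w \<Longrightarrow> s \<notin> of_nat ` {1..M} \<Longrightarrow>
          barnes_zeta M a (of_real w) s = H w s / pochhammer (s - of_nat M) M"
    by (simp_all add: cont_def)
  \<comment> \<open>Applied to \<open>barnes_L\<close>, this is \<open>S_op\<close> at 0 minus
    \<open>S_op\<close> at \<open>k * a M\<close>, the negative of the exponent of
    \<open>barnes_eta\<close>.\<close>
  define \<Delta> where "\<Delta> = (\<lambda>F. \<Sum>J\<in>Pow {1..N}. (-1) ^ card J * (F (x 0 + sum b J) - F (x k + sum b J) :: complex))"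
  have telescope: "(\<Sum>l<k. G l s) = \<Delta> (\<lambda>w. barnes_series M a (of_real w) s)" if s: "real M < Re s" for s
  proof -
    define Z where "Z = (\<lambda>l J. barnes_series M a (of_real (x l + sum b J)) s)"
    have "G l s = (\<Sum>J\<in>Pow {1..N}. (-1) ^ card J * (Z l J - Z (Suc l) J))" for l
    proof (rule has_sum_unique)
      show "((\<lambda>n. \<Sum>J\<in>Pow {1..N}. (-1) ^ card J * of_real (x l + sum b J + lattice_shift m a n) powr (- s))
              has_sum G l s) (multi_indices m)"
        using s m by (intro G_sum) auto
      show "((\<lambda>n. \<Sum>J\<in>Pow {1..N}. (-1) ^ card J * of_real (x l + sum b J + lattice_shift m a n) powr (- s))
              has_sum (\<Sum>J\<in>Pow {1..N}. (-1) ^ card J * (Z l J - Z (Suc l) J))) (multi_indices m)"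
      proof (intro has_sum_finite_sum has_sum_cmult_right)
        fix J assume "J \<in> Pow {1..N}"
        then have Z: "((\<lambda>n. of_real (x l + sum b J + lattice_shift M a n) powr (- s)) has_sum Z l J) (multi_indices M)" for l
          unfolding Z_def using xb s by (intro has_sum_barnes_series a M) auto
        have "x l + sum b J + a (Suc m) = x (Suc l) + sum b J"
          by (simp add: x_def m algebra_simps)
        from Z [of "Suc l", folded this]
        show "((\<lambda>n. of_real (x l + sum b J + lattice_shift m a n) powr (- s)) has_sum
            (Z l J - Z (Suc l) J)) (multi_indices m)"
          using Z [of l] unfolding m
          by (intro has_sum_lattice_Suc [where f = "\<lambda>y. of_real y powr (- s)"])
      qed
    qed
    then have "(\<Sum>l<k. G l s) = (\<Sum>J\<in>Pow {1..N}. (-1) ^ card J * (\<Sum>l<k. Z l J - Z (Suc l) J))"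
      unfolding sum_distrib_left by (subst sum.swap) simp
    also have "\<dots> = (\<Sum>J\<in>Pow {1..N}. (-1) ^ card J * (Z 0 J - Z k J))"
      by (intro sum.cong refl arg_cong2 [of _ _ _ _ "(*)"] sum_lessThan_telescope')
    finally show ?thesis
      by (simp add: \<Delta>_def Z_def)
  qed
  \<comment> \<open>Multiplying by the clearing factor makes both sides holomorphic across 1, ...,
    M, so the identity theorem carries the telescoped relation from \<open>Re s > M\<close> to a
    connected region around 0.\<close>
  have series_eq: "pochhammer (s - of_nat M) M * (\<Sum>l<k. G l s) = \<Delta> (\<lambda>w. H w s)"
    if s: "real m - real N < Re s" for s
  proof (rule analytic_continuation_open [of "{s. real M < Re s}" "{s. real m - real N < Re s}"
        "\<lambda>s. pochhammer (s - of_nat M) M * (\<Sum>l<k. G l s)" "\<lambda>s. \<Delta> (\<lambda>w. H w s)"])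
    show "{s. real M < Re s} \<noteq> {}"
      by (auto intro: exI [of _ "of_real (real M + 1)"])
    show "connected {s. real m - real N < Re s}"
      by (intro convex_connected convex_halfspace_Re_gt)
    show "(\<lambda>s. pochhammer (s - of_nat M) M * (\<Sum>l<k. G l s)) holomorphic_on {s. real m - real N < Re s}"
      by (intro holomorphic_intros G_holo)
    show "(\<lambda>s. \<Delta> (\<lambda>w. H w s)) holomorphic_on {s. real m - real N < Re s}"
      unfolding \<Delta>_def using xb by (intro holomorphic_intros holomorphic_on_subset [OF H_holo]) auto
    fix s assume "s \<in> {s. real M < Re s}"
    then show "pochhammer (s - of_nat M) M * (\<Sum>l<k. G l s) = \<Delta> (\<lambda>w. H w s)"
      using xb by (simp add: telescope \<Delta>_def H_series sum_distrib_left algebra_simps)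
  qed (use s m in \<open>auto intro: open_halfspace_Re_gt\<close>)
  define U where "U = {s. real m - real N < Re s} - of_nat ` {1..M}"
  have U: "open U" "0 \<in> U"
    using M m unfolding U_def by (auto intro!: open_Diff finite_imp_closed open_halfspace_Re_gt)
  have \<Delta>_zeta: "\<Delta> (\<lambda>w. barnes_zeta M a (of_real w) s) = (\<Sum>l<k. G l s)" if "s \<in> U" for s
  proof -
    have "\<Delta> (\<lambda>w. barnes_zeta M a (of_real w) s) = \<Delta> (\<lambda>w. H w s) / pochhammer (s - of_nat M) M"
      using that xb
      by (simp add: \<Delta>_def H_zeta U_def sum_divide_distrib diff_divide_distrib right_diff_distrib
          del: of_real_add of_real_sum)
    also have "\<dots> = (\<Sum>l<k. G l s)"
      using that pochhammer_shifted_nonzero [of s M] by (simp add: series_eq [symmetric] U_def)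
    finally show ?thesis .
  qed
  \<comment> \<open>For \<open>w > 0\<close> the first branch of \<open>barnes_L\<close> applies,
    namely \<open>deriv\<close> at 0; holomorphy on \<open>U\<close> makes it a genuine
    derivative.\<close>
  have zeta_deriv: "(barnes_zeta M a (of_real w) has_field_derivative barnes_L M a (of_real w)) (at 0)"
    if "0 < w" for w
  proof -
    have "(\<lambda>s. H w s / pochhammer (s - of_nat M) M) holomorphic_on U"
      using that pochhammer_shifted_nonzero [of _ M]
      by (intro holomorphic_intros holomorphic_on_subset [OF H_holo]) (auto simp: U_def)
    then have "barnes_zeta M a (of_real w) holomorphic_on U"
      by (rule holomorphic_transform) (use that in \<open>auto simp: H_zeta U_def\<close>)
    from holomorphic_derivI [OF this U] show ?thesis
      using that by (simp add: barnes_L_def)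
  qed
  have "((\<lambda>s. \<Delta> (\<lambda>w. barnes_zeta M a (of_real w) s)) has_field_derivative \<Delta> (\<lambda>w. barnes_L M a (of_real w))) (at 0)"
    unfolding \<Delta>_def using xb by (intro DERIV_sum DERIV_cmult DERIV_diff zeta_deriv) auto
  moreover have "((\<lambda>s. \<Sum>l<k. G l s) has_field_derivative (\<Sum>l<k. of_real (- r l))) (at 0)"
    by (intro DERIV_sum G_deriv)
  then have "((\<lambda>s. \<Delta> (\<lambda>w. barnes_zeta M a (of_real w) s)) has_field_derivative (\<Sum>l<k. of_real (- r l))) (at 0)"
    by (rule has_field_derivative_transform_within_open [OF _ U]) (simp add: \<Delta>_zeta)
  ultimately have "\<Delta> (\<lambda>w. barnes_L M a (of_real w)) = (\<Sum>l<k. of_real (- r l))"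
    by (rule DERIV_unique)
  moreover have "S_op N b (barnes_L M a) (of_real (real k * a M)) - S_op N b (barnes_L M a) 0 =
      - \<Delta> (\<lambda>w. barnes_L M a (of_real w))"
    by (simp add: S_op_def \<Delta>_def x_def sum_negf [symmetric] sum_subtractf [symmetric] algebra_simps)
  ultimately have "barnes_eta M N a b (of_real (real k * a M)) = exp (of_real (\<Sum>l<k. r l))"
    by (simp add: barnes_eta_def sum_negf)
  then have "barnes_eta M N a b (of_real (real k * a M)) = of_real (\<Prod>l<k. exp (r l))"
    by (simp add: exp_of_real exp_sum del: of_real_sum)
  then show ?thesis
    using prod by (intro that [of "\<lambda>l. exp (r l)"]) (auto simp: x_def m)
qed

theorem corollary4p8:
  fixes M N k :: nat and a b :: "nat \<Rightarrow> real"
    and P :: "'w measure" and \<beta> :: "'w \<Rightarrow> real"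
  assumes "1 \<le> M" and "M \<le> N"
    and "\<And>i. i \<in> {1..M} \<Longrightarrow> a i > 0"
    and "\<And>j. j \<in> {0..N} \<Longrightarrow> b j > 0"
    and "prob_space P" and "\<beta> \<in> borel_measurable P"
    and "barnes_beta_law M N a b (distr P borel \<beta>)"
  defines "factor \<equiv> \<lambda>l n. barnes_bracket N b
             (real l * a M + b 0 + (\<Sum>i=1..M-1. real (n i) * a i))"
  shows "(\<forall>l<k. \<exists>p. has_uncond_prod (factor l) p (multi_indices (M - 1))) \<and>
         integrable P (\<lambda>\<omega>. \<beta> \<omega> powr (real k * a M)) \<and>
         prob_space.expectation P (\<lambda>\<omega>. \<beta> \<omega> powr (real k * a M)) =
           (\<Prod>l<k. uncond_prod (factor l) (multi_indices (M - 1)))"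
proof -
  obtain p where eta: "barnes_eta M N a b (of_real (real k * a M)) = of_real (\<Prod>l<k. p l)"
    and "\<And>l. has_uncond_prod (\<lambda>n. barnes_bracket N b (real l * a M + b 0 + lattice_shift (M - 1) a n))
               (p l) (multi_indices (M - 1))"
    using barnes_eta_eq_prod [of M N a b k, OF assms(1-4)] by blast
  then have p: "has_uncond_prod (factor l) (p l) (multi_indices (M - 1))" for l
    by (simp add: factor_def lattice_shift_def)
  define q where "q = real k * a M"
  have "0 \<le> q" "0 < b 0"
    using assms(1) assms(3) [of M] assms(4) [of 0] by (simp_all add: q_def)
  then have "has_bochner_integral (distr P borel \<beta>) (\<lambda>x. complex_of_real x powr of_real q) (of_real (\<Prod>l<k. p l))"
    using assms(7) eta unfolding barnes_beta_law_def q_def by (metis Re_complex_of_real add.inverse_neutral neg_less_iff_less order_less_le_trans)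
  \<comment> \<open>The complex and the real \<open>powr\<close> are matched on positive reals only,
    so the support of the law in (0, 1] enters here.\<close>
  moreover have "AE x in distr P borel \<beta>. complex_of_real x powr of_real q = of_real (x powr q)"
  proof -
    have "AE x in distr P borel \<beta>. x \<in> {0<..1}"
      using assms(7) by (simp add: barnes_beta_law_def)
    then show ?thesis
      by eventually_elim (simp add: powr_of_real)
  qed
  ultimately have "has_bochner_integral (distr P borel \<beta>) (\<lambda>x. complex_of_real (x powr q)) (of_real (\<Prod>l<k. p l))"
    by (subst (asm) has_bochner_integral_cong_AE) auto
  from has_bochner_integral_Re [OF this]
  have "has_bochner_integral (distr P borel \<beta>) (\<lambda>x. x powr q) (\<Prod>l<k. p l)"
    by (simp only: Re_complex_of_real)
  then have "has_bochner_integral P (\<lambda>\<omega>. \<beta> \<omega> powr q) (\<Prod>l<k. p l)"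
    using assms(6) by (simp add: has_bochner_integral_iff integrable_distr_eq integral_distr)
  then show ?thesis
    using p uncond_prod_eqI [OF p] by (auto simp: has_bochner_integral_iff q_def)
qed

end
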